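(* Let $k$ be a perfect field of characteristic $p>0$, let $m\ge 1$, let $X=\mathbb{P}^m_k$, and let $f$ be the relative Frobenius endomorphism of $X$. Then the twisted homogeneous coordinate ring $F=\bigoplus_{n\ge 0}\Gamma\left(X,\mathcal{O}\left(\frac{p^n-1}{p-1}\right)\right)$ is not finitely generated as a $k$-algebra, unless $p=2$ and $m=1$. In the case $p=2$, $m=1$, the $k$-algebra $F$ is generated by $F_1=\Gamma(X,\mathcal{O}(1))$, but $F$ is not noetherian (neither left nor right noetherian).
   Context: Let $k[x_0,\dots,x_m]$ be the standard coordinate ring of $\mathbb{P}^m_k$. The relative Frobenius $f$ is the $k$-morphism $\mathbb{P}^m_k\to\mathbb{P}^m_k$ induced by the $k$-algebra homomorphism $x_i\mapsto x_i^p$ (also denoted $f$; it is the identity on $k$). Put $F_0=k$ and, for $n\ge1$, $F_n=\Gamma(\mathcal{O}(1)\otimes f^*\mathcal{O}(1)\otimes\cdots\otimes(f^{n-1})^*\mathcal{O}(1))=\Gamma(\mathcal{O}(1+p+\cdots+p^{n-1}))$, i.e. $F_n$ is the space of homogeneous polynomials in $k[x_0,\dots,x_m]$ of degree $\frac{p^n-1}{p-1}$. The multiplication on $F=\bigoplus_{n\ge0}F_n$ is given, for $a\in F_i$ and $c\in F_j$, by $a\cdot c=a\,f^i(c)\in F_{i+j}$ (the product on the right taken in $k[x_0,\dots,x_m]$, with $f^i(c)(x_0,\dots,x_m)=c(x_0^{p^i},\dots,x_m^{p^i})$). *)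

theory Defs
  imports "HOL-Library.Poly_Mapping" "HOL-Algebra.Ideal" "HOL-Algebra.Generated_Rings"
begin

section \<open>Perfect fields\<close>

definition perfect_field :: "'k::field itself \<Rightarrow> bool" where
  "perfect_field _ \<longleftrightarrow> CHAR('k) = 0 \<or> surj (\<lambda>x::'k. x ^ CHAR('k))"


section \<open>Polynomials in several variables\<close>

text \<open>
  A monomial is a finitely supported exponent vector, and multiplication of polynomials is the
  convolution product of \<^theory>\<open>HOL-Library.Poly_Mapping\<close>. The type has infinitely many
  variables; \<open>k[x\<^sub>0,\<dots>,x\<^sub>m]\<close> is cut out by requiring that only the variables in
  \<open>{..m}\<close> occur.
\<close>

type_synonym 'k mpoly = "(nat \<Rightarrow>\<^sub>0 nat) \<Rightarrow>\<^sub>0 'k"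

definition Const :: "'k::comm_ring_1 \<Rightarrow> 'k mpoly" where
  "Const c = Poly_Mapping.single 0 c"

definition Var :: "nat \<Rightarrow> 'k::comm_ring_1 mpoly" where
  "Var i = Poly_Mapping.single (Poly_Mapping.single i 1) 1"

definition mon_degree :: "(nat \<Rightarrow>\<^sub>0 nat) \<Rightarrow> nat" where
  "mon_degree t = (\<Sum>i\<in>Poly_Mapping.keys t. Poly_Mapping.lookup t i)"

text \<open>The degree \<open>d\<close> homogeneous part of \<open>k[x\<^sub>0,\<dots>,x\<^sub>m]\<close>, that is, \<open>\<Gamma>(\<bbbP>\<^sup>m, \<O>(d))\<close>.\<close>

definition homogeneous_part :: "nat \<Rightarrow> nat \<Rightarrow> 'k::comm_ring_1 mpoly set" where
  "homogeneous_part m d =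
     {P. \<forall>t\<in>Poly_Mapping.keys P. Poly_Mapping.keys t \<subseteq> {..m} \<and> mon_degree t = d}"

definition mpoly_subst :: "(nat \<Rightarrow> 'k mpoly) \<Rightarrow> 'k::comm_ring_1 mpoly \<Rightarrow> 'k mpoly" where
  "mpoly_subst g P =
     (\<Sum>t\<in>Poly_Mapping.keys P. Const (Poly_Mapping.lookup P t) *
        (\<Prod>i\<in>Poly_Mapping.keys t. g i ^ Poly_Mapping.lookup t i))"

text \<open>The relative Frobenius: it fixes the coefficients.\<close>

definition rel_frob :: "nat \<Rightarrow> 'k::comm_ring_1 mpoly \<Rightarrow> 'k mpoly" where
  "rel_frob p = mpoly_subst (\<lambda>i. Var i ^ p)"


section \<open>The twisted homogeneous coordinate ring\<close>

text \<open>
  An element of the direct sum is a finitely supported sequence whose \<open>n\<close>-th entry lies in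
  \<open>F\<^sub>n\<close>. The product is the biadditive extension of \<open>a \<cdot> c = a f\<^sup>i(c)\<close> for
  \<open>a \<in> F\<^sub>i\<close>, \<open>c \<in> F\<^sub>j\<close>.
\<close>

definition tw_mult ::
  "nat \<Rightarrow> (nat \<Rightarrow>\<^sub>0 'k::comm_ring_1 mpoly) \<Rightarrow> (nat \<Rightarrow>\<^sub>0 'k mpoly) \<Rightarrow> (nat \<Rightarrow>\<^sub>0 'k mpoly)" where
  "tw_mult p a c =
     (\<Sum>i\<in>Poly_Mapping.keys a. \<Sum>j\<in>Poly_Mapping.keys c.
        Poly_Mapping.single (i + j)
          (Poly_Mapping.lookup a i * (rel_frob p ^^ i) (Poly_Mapping.lookup c j)))"

definition tw_part :: "nat \<Rightarrow> nat \<Rightarrow> nat \<Rightarrow> 'k::comm_ring_1 mpoly set" where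
  "tw_part p m n = homogeneous_part m ((p ^ n - 1) div (p - 1))"

definition tw_ring :: "nat \<Rightarrow> nat \<Rightarrow> (nat \<Rightarrow>\<^sub>0 'k::comm_ring_1 mpoly) ring" where
  "tw_ring p m =
     \<lparr> carrier = {a. \<forall>n. Poly_Mapping.lookup a n \<in> tw_part p m n},
       monoid.mult = tw_mult p,
       one = Poly_Mapping.single 0 1,
       zero = 0,
       add = (+) \<rparr>"

text \<open>The copies of \<open>F\<^sub>n\<close> and of \<open>k = F\<^sub>0\<close> inside the direct sum.\<close>

definition tw_component :: "nat \<Rightarrow> nat \<Rightarrow> nat \<Rightarrow> (nat \<Rightarrow>\<^sub>0 'k::comm_ring_1 mpoly) set" where
  "tw_component p m n = Poly_Mapping.single n ` tw_part p m n"

definition tw_scalars :: "(nat \<Rightarrow>\<^sub>0 'k::comm_ring_1 mpoly) set" where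
  "tw_scalars = {Poly_Mapping.single 0 (Const c) | c. True}"


section \<open>Finite generation and noetherianity of noncommutative rings\<close>

text \<open>For \<open>K\<close> the image of the ground ring, \<open>S\<close> generates \<open>R\<close> as a \<open>K\<close>-algebra.\<close>

definition generates_algebra :: "'a set \<Rightarrow> ('a, 'b) ring_scheme \<Rightarrow> 'a set \<Rightarrow> bool" where
  "generates_algebra K R S \<longleftrightarrow> S \<subseteq> carrier R \<and> generate_ring R (K \<union> S) = carrier R"

definition finitely_generated_algebra :: "'a set \<Rightarrow> ('a, 'b) ring_scheme \<Rightarrow> bool" where
  "finitely_generated_algebra K R \<longleftrightarrow> (\<exists>S. finite S \<and> generates_algebra K R S)"

definition left_ideal :: "'a set \<Rightarrow> ('a, 'b) ring_scheme \<Rightarrow> bool" where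
  "left_ideal I R \<longleftrightarrow> additive_subgroup I R \<and> (\<forall>a\<in>I. \<forall>x\<in>carrier R. x \<otimes>\<^bsub>R\<^esub> a \<in> I)"

definition right_ideal :: "'a set \<Rightarrow> ('a, 'b) ring_scheme \<Rightarrow> bool" where
  "right_ideal I R \<longleftrightarrow> additive_subgroup I R \<and> (\<forall>a\<in>I. \<forall>x\<in>carrier R. a \<otimes>\<^bsub>R\<^esub> x \<in> I)"

text \<open>
  The library's \<open>noetherian_ring\<close> concerns two-sided ideals; these are its one-sided analogues.
\<close>

definition left_noetherian :: "('a, 'b) ring_scheme \<Rightarrow> bool" where
  "left_noetherian R \<longleftrightarrow>
     (\<forall>I. left_ideal I R \<longrightarrow>
       (\<exists>A \<subseteq> carrier R. finite A \<and> I = \<Inter>{J. left_ideal J R \<and> A \<subseteq> J}))"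

definition right_noetherian :: "('a, 'b) ring_scheme \<Rightarrow> bool" where
  "right_noetherian R \<longleftrightarrow>
     (\<forall>I. right_ideal I R \<longrightarrow>
       (\<exists>A \<subseteq> carrier R. finite A \<and> I = \<Inter>{J. right_ideal J R \<and> A \<subseteq> J}))"


section \<open>Well-definedness of the twisted ring\<close>

lemma pm_add_induct [case_names zero single add]:
  fixes a :: "'a \<Rightarrow>\<^sub>0 'b::comm_monoid_add"
  assumes "P 0" and "\<And>i x. P (Poly_Mapping.single i x)" and "\<And>a b. P a \<Longrightarrow> P b \<Longrightarrow> P (a + b)"
  shows "P a"
proof -
  have "P (\<Sum>i\<in>A. Poly_Mapping.single i (Poly_Mapping.lookup a i))" if "finite A" for A
    using that by (induction A) (auto intro: assms)
  moreover have "(\<Sum>i\<in>Poly_Mapping.keys a. Poly_Mapping.single i (Poly_Mapping.lookup a i)) = a"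
    by (rule poly_mapping_eqI)
      (auto simp: lookup_sum lookup_single when_def sum.delta in_keys_iff)
  ultimately show ?thesis by (metis finite_keys)
qed

lemma Const_add: "Const (a + b) = Const a + Const b"
  by (simp add: Const_def single_add)

lemma mpoly_subst_superset:
  assumes "finite A" "Poly_Mapping.keys P \<subseteq> A"
  shows "mpoly_subst g P =
    (\<Sum>t\<in>A. Const (Poly_Mapping.lookup P t) *
        (\<Prod>i\<in>Poly_Mapping.keys t. g i ^ Poly_Mapping.lookup t i))"
  unfolding mpoly_subst_def
  by (rule sum.mono_neutral_left) (use assms in \<open>auto simp: in_keys_iff Const_def\<close>)

lemma mpoly_subst_add: "mpoly_subst g (P + Q) = mpoly_subst g P + mpoly_subst g Q"
proof -
  let ?A = "Poly_Mapping.keys P \<union> Poly_Mapping.keys Q"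
  have "Poly_Mapping.keys (P + Q) \<subseteq> ?A" by (rule keys_add)
  then show ?thesis
    by (subst (1 2 3) mpoly_subst_superset[of ?A])
      (auto simp: lookup_add Const_add distrib_right sum.distrib)
qed

lemma Var_power: "Var i ^ n = (Poly_Mapping.single (Poly_Mapping.single i n) 1 :: 'k::comm_ring_1 mpoly)"
  by (induction n) (simp_all add: Var_def mult_single single_add[symmetric] flip: single_one)

lemma prod_single:
  "finite A \<Longrightarrow> (\<Prod>i\<in>A. Poly_Mapping.single (h i) (1::'k::comm_ring_1)) = Poly_Mapping.single (\<Sum>i\<in>A. h i) 1"
  for h :: "nat \<Rightarrow> (nat \<Rightarrow>\<^sub>0 nat)"
  by (induction A rule: finite_induct) (simp_all add: mult_single)

definition mon_scale :: "nat \<Rightarrow> (nat \<Rightarrow>\<^sub>0 nat) \<Rightarrow> (nat \<Rightarrow>\<^sub>0 nat)" where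
  "mon_scale p t = Poly_Mapping.map ((*) p) t"

lemma lookup_mon_scale: "Poly_Mapping.lookup (mon_scale p t) i = p * Poly_Mapping.lookup t i"
  by (simp add: mon_scale_def map.rep_eq when_def)

lemma rel_frob_single: "rel_frob p (Poly_Mapping.single t c) = Poly_Mapping.single (mon_scale p t) c"
proof -
  have s: "(\<Sum>i\<in>Poly_Mapping.keys t. Poly_Mapping.single i (p * Poly_Mapping.lookup t i)) = mon_scale p t"
    by (rule poly_mapping_eqI)
      (auto simp: lookup_sum lookup_single when_def sum.delta in_keys_iff lookup_mon_scale)
  have v: "(Var i ^ p) ^ n = (Poly_Mapping.single (Poly_Mapping.single i (p * n)) 1 :: 'a mpoly)" for i n
    using Var_power[of i "p * n"] by (simp only: power_mult)
  show ?thesis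
    unfolding rel_frob_def
    by (subst mpoly_subst_superset[of "{t}"])
      (auto simp: Const_def v prod_single mult_single s)
qed

lemma rel_frob_add: "rel_frob p (P + Q) = rel_frob p P + rel_frob p Q"
  by (simp add: rel_frob_def mpoly_subst_add)

lemma rel_frob_0 [simp]: "rel_frob p 0 = 0"
  by (simp add: rel_frob_def mpoly_subst_def)

lemma mon_scale_add: "mon_scale p (s + t) = mon_scale p s + mon_scale p t"
  by (rule poly_mapping_eqI) (simp add: lookup_mon_scale lookup_add distrib_left)

lemma rel_frob_1 [simp]: "rel_frob p 1 = 1"
proof -
  have "mon_scale p 0 = 0" by (rule poly_mapping_eqI) (simp add: lookup_mon_scale)
  then show ?thesis by (metis rel_frob_single single_one)
qed

lemma rel_frob_mult: "rel_frob p (P * Q) = rel_frob p P * rel_frob p Q"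
proof (induction P rule: pm_add_induct)
  case (single s c)
  show ?case
    by (induction Q rule: pm_add_induct)
      (simp_all add: rel_frob_single rel_frob_add mult_single mon_scale_add distrib_left)
qed (simp_all add: rel_frob_add distrib_right)

lemma rel_frob_pow_add: "(rel_frob p ^^ i) (P + Q) = (rel_frob p ^^ i) P + (rel_frob p ^^ i) Q"
  by (induction i) (simp_all add: rel_frob_add)

lemma rel_frob_pow_mult: "(rel_frob p ^^ i) (P * Q) = (rel_frob p ^^ i) P * (rel_frob p ^^ i) Q"
  by (induction i) (simp_all add: rel_frob_mult)

lemma rel_frob_pow_0 [simp]: "(rel_frob p ^^ i) 0 = 0"
  by (induction i) simp_all

lemma rel_frob_pow_1 [simp]: "(rel_frob p ^^ i) 1 = 1"
  by (induction i) simp_all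

lemma homogeneous_part_0 [simp]: "0 \<in> homogeneous_part m d"
  by (simp add: homogeneous_part_def)

lemma homogeneous_part_add:
  "P \<in> homogeneous_part m d \<Longrightarrow> Q \<in> homogeneous_part m d \<Longrightarrow> P + Q \<in> homogeneous_part m d"
  using keys_add[of P Q] unfolding homogeneous_part_def by blast

lemma homogeneous_part_uminus: "P \<in> homogeneous_part m d \<Longrightarrow> - P \<in> homogeneous_part m d"
  by (simp add: homogeneous_part_def in_keys_iff)

lemma mon_degree_superset:
  "finite A \<Longrightarrow> Poly_Mapping.keys t \<subseteq> A \<Longrightarrow> mon_degree t = (\<Sum>i\<in>A. Poly_Mapping.lookup t i)"
  unfolding mon_degree_def by (rule sum.mono_neutral_left) (auto simp: in_keys_iff)

lemma mon_degree_add: "mon_degree (s + t) = mon_degree s + mon_degree t"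
proof -
  let ?A = "Poly_Mapping.keys s \<union> Poly_Mapping.keys t"
  show ?thesis
    using keys_add[of s t]
    by (subst (1 2 3) mon_degree_superset[of ?A]) (auto simp: lookup_add sum.distrib)
qed

lemma homogeneous_part_mult:
  assumes "P \<in> homogeneous_part m d" "Q \<in> homogeneous_part m e"
  shows "P * Q \<in> homogeneous_part m (d + e)"
  unfolding homogeneous_part_def
proof (clarify, goal_cases)
  case (1 u)
  then obtain s t where "u = s + t" "s \<in> Poly_Mapping.keys P" "t \<in> Poly_Mapping.keys Q"
    using keys_mult[of P Q] by blast
  then show ?case
    using assms keys_add[of s t] by (fastforce simp: homogeneous_part_def mon_degree_add)
qed

lemma homogeneous_part_rel_frob:
  assumes "P \<in> homogeneous_part m d"
  shows "rel_frob p P \<in> homogeneous_part m (p * d)"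
proof -
  have P: "P = (\<Sum>t\<in>Poly_Mapping.keys P. Poly_Mapping.single t (Poly_Mapping.lookup P t))"
    by (rule poly_mapping_eqI)
      (auto simp: lookup_sum lookup_single when_def sum.delta in_keys_iff)
  have sum: "rel_frob p (\<Sum>t\<in>A. f t) = (\<Sum>t\<in>A. rel_frob p (f t))"
    for f :: "(nat \<Rightarrow>\<^sub>0 nat) \<Rightarrow> 'a mpoly" and A
    by (induction A rule: infinite_finite_induct) (simp_all add: rel_frob_add)
  have hs: "(\<Sum>t\<in>A. f t) \<in> homogeneous_part m e"
    if "\<And>t. t \<in> A \<Longrightarrow> f t \<in> homogeneous_part m e"
    for f :: "(nat \<Rightarrow>\<^sub>0 nat) \<Rightarrow> 'a mpoly" and A e
    using that by (induction A rule: infinite_finite_induct) (auto intro: homogeneous_part_add)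
  have "Poly_Mapping.single (mon_scale p t) (Poly_Mapping.lookup P t) \<in> homogeneous_part m (p * d)"
    if "t \<in> Poly_Mapping.keys P" for t
  proof -
    have t: "Poly_Mapping.keys t \<subseteq> {..m}" "mon_degree t = d"
      using that assms by (auto simp: homogeneous_part_def)
    have k: "Poly_Mapping.keys (mon_scale p t) \<subseteq> Poly_Mapping.keys t"
      by (auto simp: in_keys_iff lookup_mon_scale)
    have "mon_degree (mon_scale p t) = p * d"
      by (subst mon_degree_superset[OF _ k])
        (simp_all add: lookup_mon_scale t(2)[symmetric] mon_degree_def sum_distrib_left)
    then show ?thesis
      using k t(1) by (auto simp: homogeneous_part_def)
  qed
  then show ?thesis
    by (subst P) (auto simp: sum rel_frob_single intro!: hs)
qed

lemma homogeneous_part_rel_frob_pow: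
  "P \<in> homogeneous_part m d \<Longrightarrow> (rel_frob p ^^ i) P \<in> homogeneous_part m (p ^ i * d)"
proof (induction i)
  case (Suc i)
  from homogeneous_part_rel_frob[OF Suc.IH[OF Suc.prems], of p] show ?case
    by (simp add: mult.assoc)
qed simp

lemma tw_degree_eq_sum: "(p ^ n - 1) div (p - 1) = (\<Sum>i<n. p ^ i)" if "p \<ge> 2" for p :: nat
proof -
  from that have "p \<noteq> 0" by simp
  then obtain q where "p = Suc q" using not0_implies_Suc by blast
  then have "p ^ n = (p - 1) * (\<Sum>i<n. p ^ i) + 1"
    by (induction n) (auto simp: algebra_simps)
  then have "p ^ n - 1 = (p - 1) * (\<Sum>i<n. p ^ i)" by simp
  with that show ?thesis by simp
qed

lemma tw_degree_add:
  "(p ^ (i + j) - 1) div (p - 1) = (p ^ i - 1) div (p - 1) + p ^ i * ((p ^ j - 1) div (p - 1))"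
  for p :: nat
proof (cases "p \<ge> 2")
  case True
  have "(\<Sum>l<i + j. p ^ l) = (\<Sum>l<i. p ^ l) + p ^ i * (\<Sum>l<j. p ^ l)"
    by (induction j) (simp_all add: power_add distrib_left)
  then show ?thesis unfolding tw_degree_eq_sum[OF True] .
next
  case False
  then have "p - 1 = 0" by simp
  then show ?thesis by simp
qed

lemma tw_mult_superset:
  assumes "finite A" "Poly_Mapping.keys a \<subseteq> A" "finite B" "Poly_Mapping.keys c \<subseteq> B"
  shows "tw_mult p a c =
     (\<Sum>i\<in>A. \<Sum>j\<in>B. Poly_Mapping.single (i + j)
          (Poly_Mapping.lookup a i * (rel_frob p ^^ i) (Poly_Mapping.lookup c j)))"
proof -
  have "tw_mult p a c = (\<Sum>i\<in>Poly_Mapping.keys a. \<Sum>j\<in>B. Poly_Mapping.single (i + j)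
          (Poly_Mapping.lookup a i * (rel_frob p ^^ i) (Poly_Mapping.lookup c j)))"
    unfolding tw_mult_def
    by (intro sum.cong refl sum.mono_neutral_left) (use assms in \<open>auto simp: in_keys_iff\<close>)
  also have "\<dots> = (\<Sum>i\<in>A. \<Sum>j\<in>B. Poly_Mapping.single (i + j)
          (Poly_Mapping.lookup a i * (rel_frob p ^^ i) (Poly_Mapping.lookup c j)))"
    by (intro sum.mono_neutral_left) (use assms in \<open>auto simp: in_keys_iff\<close>)
  finally show ?thesis .
qed

lemma tw_mult_add_left: "tw_mult p (a + b) c = tw_mult p a c + tw_mult p b c"
proof -
  let ?A = "Poly_Mapping.keys a \<union> Poly_Mapping.keys b" and ?B = "Poly_Mapping.keys c"
  show ?thesis
    using keys_add[of a b]
    by (subst (1 2 3) tw_mult_superset[of ?A _ ?B])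
      (auto simp: lookup_add distrib_right single_add sum.distrib)
qed

lemma tw_mult_add_right: "tw_mult p a (b + c) = tw_mult p a b + tw_mult p a c"
proof -
  let ?A = "Poly_Mapping.keys a" and ?B = "Poly_Mapping.keys b \<union> Poly_Mapping.keys c"
  show ?thesis
    using keys_add[of b c]
    by (subst (1 2 3) tw_mult_superset[of ?A _ ?B])
      (auto simp: lookup_add distrib_left rel_frob_pow_add single_add sum.distrib)
qed

lemma tw_mult_0 [simp]: "tw_mult p 0 c = 0" "tw_mult p a 0 = 0"
  by (simp_all add: tw_mult_def)

lemma tw_mult_single:
  "tw_mult p (Poly_Mapping.single i x) (Poly_Mapping.single j y) =
     Poly_Mapping.single (i + j) (x * (rel_frob p ^^ i) y)"
  by (subst tw_mult_superset[of "{i}" _ "{j}"]) auto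

lemma tw_mult_assoc: "tw_mult p (tw_mult p a b) c = tw_mult p a (tw_mult p b c)"
proof (induction a rule: pm_add_induct)
  case (single i x)
  show ?case
  proof (induction b rule: pm_add_induct)
    case (single j y)
    show ?case
      by (induction c rule: pm_add_induct)
        (simp_all add: tw_mult_single tw_mult_add_right rel_frob_pow_mult funpow_add
          add.assoc mult.assoc)
  qed (simp_all add: tw_mult_add_left tw_mult_add_right)
qed (simp_all add: tw_mult_add_left)

lemma tw_mult_1_left: "tw_mult p 1 a = a"
  by (induction a rule: pm_add_induct)
    (simp_all add: tw_mult_single[of p 0 1, simplified] tw_mult_add_right)

lemma tw_mult_1_right: "tw_mult p a 1 = a"
  by (induction a rule: pm_add_induct)
    (simp_all add: tw_mult_single[of p _ _ 0 1, simplified] tw_mult_add_left)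

lemma one_in_tw_part: "1 \<in> tw_part p m 0"
  by (simp add: tw_part_def homogeneous_part_def mon_degree_def)

lemma tw_mult_closed:
  assumes "\<And>n. Poly_Mapping.lookup a n \<in> tw_part p m n"
    and "\<And>n. Poly_Mapping.lookup c n \<in> tw_part p m n"
  shows "Poly_Mapping.lookup (tw_mult p a c) n \<in> tw_part p m n"
proof -
  have sum: "(\<Sum>i\<in>A. f i) \<in> tw_part p m n" if "\<And>i. i \<in> A \<Longrightarrow> f i \<in> tw_part p m n"
    for f :: "nat \<Rightarrow> 'a mpoly" and A
    using that by (induction A rule: infinite_finite_induct)
      (auto simp: tw_part_def intro: homogeneous_part_add)
  have "Poly_Mapping.lookup a i * (rel_frob p ^^ i) (Poly_Mapping.lookup c j) \<in> tw_part p m (i + j)"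
    for i j
    using homogeneous_part_mult[OF _ homogeneous_part_rel_frob_pow] assms(1)[of i] assms(2)[of j]
    unfolding tw_part_def tw_degree_add by blast
  then show ?thesis
    unfolding tw_mult_def lookup_sum
    by (intro sum) (auto simp: lookup_single when_def tw_part_def)
qed

lemma ring_tw_ring: "ring (tw_ring p m)"
proof (rule ringI)
  have neg: "\<exists>y. (\<forall>n. Poly_Mapping.lookup y n \<in> tw_part p m n) \<and> y + x = 0"
    if "\<forall>n. Poly_Mapping.lookup x n \<in> tw_part p m n" for x :: "nat \<Rightarrow>\<^sub>0 'a mpoly"
    using that by (intro exI[of _ "- x"]) (auto simp: tw_part_def intro: homogeneous_part_uminus)
  show "abelian_group (tw_ring p m :: (nat \<Rightarrow>\<^sub>0 'a mpoly) ring)"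
    by (rule abelian_groupI)
      (use neg in \<open>auto simp: tw_ring_def tw_part_def lookup_add ac_simps intro: homogeneous_part_add\<close>)
  show "Group.monoid (tw_ring p m :: (nat \<Rightarrow>\<^sub>0 'a mpoly) ring)"
    by (rule Group.monoidI)
      (auto simp: tw_ring_def tw_mult_closed tw_mult_assoc tw_mult_1_left tw_mult_1_right
        lookup_one when_def one_in_tw_part[unfolded One_nat_def], simp add: tw_part_def)
qed (auto simp: tw_ring_def tw_mult_add_left tw_mult_add_right)

lemma tw_scalars_central:
  assumes "x \<in> tw_scalars"
  shows "x \<in> carrier (tw_ring p m)" and "tw_mult p x a = tw_mult p a x"
proof -
  obtain c where c: "x = Poly_Mapping.single 0 (Const c)"
    using assms by (auto simp: tw_scalars_def)
  have "mon_scale p 0 = 0" by (rule poly_mapping_eqI) (simp add: lookup_mon_scale)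
  then have "rel_frob p (Const c) = Const c" by (simp add: Const_def rel_frob_single)
  then have "(rel_frob p ^^ i) (Const c) = Const c" for i by (induction i) simp_all
  then show "tw_mult p x a = tw_mult p a x"
    by (induction a rule: pm_add_induct)
      (simp_all add: c tw_mult_single tw_mult_add_left tw_mult_add_right mult.commute)
  show "x \<in> carrier (tw_ring p m)"
    by (auto simp: c tw_ring_def lookup_single when_def tw_part_def homogeneous_part_def
        Const_def mon_degree_def split: if_splits)
qed

end

theory Submission
  imports Defs
begin

text \<open>
  The ring \<open>F\<close> is a twisted monoid algebra: its basis consists of the pairs \<open>(n, s)\<close> with
  \<open>|s| = 1 + p + \<dots> + p\<^sup>n\<^sup>-\<^sup>1\<close>, multiplied by \<open>(i, u)(j, t) = (i + j, u + p\<^sup>i t)\<close>. The exponent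
  \<open>s = (p\<^sup>n\<^sup>-\<^sup>1 - 1) e\<^sub>0 + e\<^sub>1 + (1 + \<dots> + p\<^sup>n\<^sup>-\<^sup>2) e\<^sub>m\<close> is indecomposable unless \<open>p = 2\<close> and
  \<open>m = 1\<close>: in a factorization with \<open>0 < i < n\<close> one has
  \<open>u\<^sub>0 \<equiv> -1 (mod p\<^sup>i)\<close>, so \<open>u\<^sub>0 \<ge> p\<^sup>i - 1 \<ge> |u|\<close>, which forces \<open>p = 2\<close> and \<open>u\<^sub>1 = 0\<close>, against
  \<open>s\<^sub>1 = 1\<close> when \<open>m \<ge> 2\<close>. So \<open>F\<close> needs generators in every degree.
  If \<open>p = 2\<close> and \<open>m = 1\<close>, reading off binary digits shows that \<open>F\<close> is the free algebra on
  \<open>x = x\<^sub>0\<close> and \<open>y = x\<^sub>1\<close>. The ideal of combinations of words containing \<open>x\<close> is not finitely generated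
  on either side, because every left (right) generating set must involve all words \<open>x y\<^sup>n\<close>
  (\<open>y\<^sup>n x\<close>).
\<close>

section \<open>Monomials\<close>

abbreviation coef :: "(nat \<Rightarrow>\<^sub>0 'k::comm_ring_1 mpoly) \<Rightarrow> nat \<Rightarrow> (nat \<Rightarrow>\<^sub>0 nat) \<Rightarrow> 'k" where
  "coef a n s \<equiv> Poly_Mapping.lookup (Poly_Mapping.lookup a n) s"

text \<open>Exponents of the monomial basis of \<open>F\<^sub>n\<close>; the pairs
  \<open>(n, s)\<close> with \<open>s\<close> in this set form the monoid underlying
  \<open>F\<close>.\<close>

definition tw_exps :: "nat \<Rightarrow> nat \<Rightarrow> nat \<Rightarrow> (nat \<Rightarrow>\<^sub>0 nat) set" where
  "tw_exps p m n = {s. Poly_Mapping.keys s \<subseteq> {..m} \<and> mon_degree s = (p ^ n - 1) div (p - 1)}"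

lemma sum_single_lookup:
  "(\<Sum>i\<in>Poly_Mapping.keys a. Poly_Mapping.single i (Poly_Mapping.lookup a i)) = a"
  by (rule poly_mapping_eqI)
    (auto simp: lookup_sum lookup_single when_def sum.delta in_keys_iff)

lemma mon_scale_1 [simp]: "mon_scale (Suc 0) t = t"
  by (rule poly_mapping_eqI) (simp add: lookup_mon_scale)

lemma mon_scale_0_right [simp]: "mon_scale p 0 = 0"
  by (rule poly_mapping_eqI) (simp add: lookup_mon_scale)

lemma mon_scale_mon_scale: "mon_scale p (mon_scale q t) = mon_scale (p * q) t"
  by (rule poly_mapping_eqI) (simp add: lookup_mon_scale)

lemma mon_scale_single: "mon_scale p (Poly_Mapping.single i a) = Poly_Mapping.single i (p * a)"
  by (rule poly_mapping_eqI) (simp add: lookup_mon_scale lookup_single when_def)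

lemma mon_degree_single [simp]: "mon_degree (Poly_Mapping.single i a) = a"
  by (simp add: mon_degree_superset[of "{i}"])

lemma mon_degree_0 [simp]: "mon_degree 0 = 0"
  by (simp add: mon_degree_def)

lemma mon_degree_eq_0_iff [simp]: "mon_degree t = 0 \<longleftrightarrow> t = 0"
proof
  assume "mon_degree t = 0"
  then show "t = 0" by (intro poly_mapping_eqI) (simp add: mon_degree_def in_keys_iff)
qed simp

lemma lookup_le_mon_degree: "Poly_Mapping.lookup t i \<le> mon_degree t"
proof (cases "i \<in> Poly_Mapping.keys t")
  case True
  then show ?thesis unfolding mon_degree_def by (intro member_le_sum) auto
qed (simp add: in_keys_iff)

lemma lookup_add_le_mon_degree:
  assumes "i \<noteq> j"
  shows "Poly_Mapping.lookup t i + Poly_Mapping.lookup t j \<le> mon_degree t"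
proof -
  let ?A = "Poly_Mapping.keys t \<union> {i, j}"
  have "(\<Sum>l\<in>{i, j}. Poly_Mapping.lookup t l) \<le> (\<Sum>l\<in>?A. Poly_Mapping.lookup t l)"
    by (rule sum_mono2) auto
  then show ?thesis using assms by (simp add: mon_degree_superset[of ?A] del: Un_insert_right)
qed

lemma binary_exponent:
  assumes "Poly_Mapping.keys t \<subseteq> {..Suc 0}"
  shows "t = Poly_Mapping.single 0 (Poly_Mapping.lookup t 0)
    + Poly_Mapping.single 1 (Poly_Mapping.lookup t 1)"
proof (rule poly_mapping_eqI)
  fix i
  have "i \<le> Suc 0" if "Poly_Mapping.lookup t i \<noteq> 0" using that assms by (auto simp: in_keys_iff)
  then show "Poly_Mapping.lookup t i = Poly_Mapping.lookup (Poly_Mapping.single 0 (Poly_Mapping.lookup t 0)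
    + Poly_Mapping.single 1 (Poly_Mapping.lookup t 1)) i"
    by (cases "i = 0"; cases "i = 1") (auto simp: lookup_add lookup_single when_def)
qed

lemma tw_exps_0 [simp]: "tw_exps p m 0 = {0}"
  by (auto simp: tw_exps_def)

lemma tw_exps_two: "s \<in> tw_exps 2 m n \<longleftrightarrow> Poly_Mapping.keys s \<subseteq> {..m} \<and> mon_degree s = 2 ^ n - 1"
  by (simp add: tw_exps_def)

section \<open>Supports of elements and of twisted products\<close>

lemma coef_carrier:
  assumes "a \<in> carrier (tw_ring p m)" "coef a n s \<noteq> 0"
  shows "s \<in> tw_exps p m n"
proof -
  have "Poly_Mapping.lookup a n \<in> tw_part p m n" using assms(1) by (simp add: tw_ring_def)
  then show ?thesis
    using assms(2) by (auto simp: tw_part_def homogeneous_part_def tw_exps_def in_keys_iff)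
qed

lemma monomial_in_carrier:
  "s \<in> tw_exps p m n \<Longrightarrow> Poly_Mapping.single n (Poly_Mapping.single s c) \<in> carrier (tw_ring p m)"
  by (auto simp: tw_ring_def tw_part_def homogeneous_part_def tw_exps_def lookup_single when_def
      split: if_splits)

lemma rel_frob_pow_single:
  "(rel_frob p ^^ i) (Poly_Mapping.single t c) = Poly_Mapping.single (mon_scale (p ^ i) t) c"
  by (induction i) (simp_all add: rel_frob_single mon_scale_mon_scale)

text \<open>By additivity it suffices to look at single monomials, where the \<open>i\<close>-th
  power of the Frobenius multiplies the exponent by \<open>p ^ i\<close> and keeps the
  coefficient.\<close>

lemma lookup_rel_frob_pow_nonzero:
  assumes "Poly_Mapping.lookup ((rel_frob p ^^ i) P) s \<noteq> 0"
  obtains t where "s = mon_scale (p ^ i) t" "Poly_Mapping.lookup P t \<noteq> 0"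
proof -
  let ?g = "\<lambda>t. Poly_Mapping.single t (Poly_Mapping.lookup P t)"
  have "(rel_frob p ^^ i) P = (rel_frob p ^^ i) (\<Sum>t\<in>Poly_Mapping.keys P. ?g t)"
    by (simp add: sum_single_lookup)
  also have "\<dots> = (\<Sum>t\<in>Poly_Mapping.keys P. (rel_frob p ^^ i) (?g t))"
    by (subst sum_comp_morphism[symmetric]) (simp_all add: rel_frob_pow_add)
  finally have "(\<Sum>t\<in>Poly_Mapping.keys P.
      Poly_Mapping.lookup (Poly_Mapping.single (mon_scale (p ^ i) t) (Poly_Mapping.lookup P t)) s) \<noteq> 0"
    using assms by (simp add: lookup_sum rel_frob_pow_single)
  then obtain t where "Poly_Mapping.lookup
      (Poly_Mapping.single (mon_scale (p ^ i) t) (Poly_Mapping.lookup P t)) s \<noteq> 0"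
    by (rule sum.not_neutral_contains_not_neutral)
  with that show thesis by (auto simp: lookup_single when_def split: if_splits)
qed

text \<open>The support of a product lies in the product of the supports. Cancellation may make the
  inclusion strict, but vanishing of coefficients is all that is deduced from it.\<close>

lemma coef_tw_mult_nonzero:
  assumes "coef (tw_mult p a c) n s \<noteq> 0"
  obtains i j u t where "n = i + j" "s = u + mon_scale (p ^ i) t" "coef a i u \<noteq> 0" "coef c j t \<noteq> 0"
proof -
  obtain i where "(\<Sum>j\<in>Poly_Mapping.keys c. Poly_Mapping.lookup (Poly_Mapping.lookup
      (Poly_Mapping.single (i + j) (Poly_Mapping.lookup a i * (rel_frob p ^^ i) (Poly_Mapping.lookup c j))) n) s)
      \<noteq> 0"
    using assms unfolding tw_mult_def lookup_sum
    by (auto elim: sum.not_neutral_contains_not_neutral)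
  then obtain j where ij: "Poly_Mapping.lookup (Poly_Mapping.lookup (Poly_Mapping.single (i + j)
      (Poly_Mapping.lookup a i * (rel_frob p ^^ i) (Poly_Mapping.lookup c j))) n) s \<noteq> 0"
    by (rule sum.not_neutral_contains_not_neutral)
  then have n: "n = i + j" by (auto simp: lookup_single when_def split: if_splits)
  with ij have "s \<in> Poly_Mapping.keys (Poly_Mapping.lookup a i * (rel_frob p ^^ i) (Poly_Mapping.lookup c j))"
    by (simp add: in_keys_iff)
  then obtain u v where "s = u + v" and u: "coef a i u \<noteq> 0"
    and v: "Poly_Mapping.lookup ((rel_frob p ^^ i) (Poly_Mapping.lookup c j)) v \<noteq> 0"
    using keys_mult by (fastforce simp: in_keys_iff)
  moreover obtain t where "v = mon_scale (p ^ i) t" "coef c j t \<noteq> 0"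
    using v by (rule lookup_rel_frob_pow_nonzero)
  ultimately show thesis using that n by blast
qed

section \<open>Subrings and ideals given by vanishing coefficients\<close>

text \<open>The span of the basis monomials whose index lies outside \<open>T\<close>. In this form,
  being a subring or a one-sided ideal reduces to how the elements of \<open>T\<close> factor in the
  monoid of exponents.\<close>

definition vanishing ::
  "nat \<Rightarrow> nat \<Rightarrow> (nat \<times> (nat \<Rightarrow>\<^sub>0 nat)) set \<Rightarrow> (nat \<Rightarrow>\<^sub>0 'k::comm_ring_1 mpoly) set" where
  "vanishing p m T = {a \<in> carrier (tw_ring p m). \<forall>(n, s)\<in>T. coef a n s = 0}"

lemma vanishingD:
  assumes "a \<in> vanishing p m T"
  shows "a \<in> carrier (tw_ring p m)" and "(n, s) \<in> T \<Longrightarrow> coef a n s = 0"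
  using assms by (auto simp: vanishing_def)

lemma tw_ring_simps:
  "mult (tw_ring p m) = tw_mult p" "one (tw_ring p m) = 1"
  "zero (tw_ring p m) = 0" "add (tw_ring p m) = (+)"
  by (simp_all add: tw_ring_def)

lemma tw_ring_uminus_closed:
  "a \<in> carrier (tw_ring p m) \<Longrightarrow> - a \<in> carrier (tw_ring p m)"
  by (auto simp: tw_ring_def tw_part_def intro: homogeneous_part_uminus)

lemma tw_ring_a_inv:
  assumes "a \<in> carrier (tw_ring p m)"
  shows "a_inv (tw_ring p m) a = - a"
proof -
  interpret ring "tw_ring p m :: (nat \<Rightarrow>\<^sub>0 'a mpoly) ring" by (rule ring_tw_ring)
  show ?thesis
    by (rule minus_equality) (simp_all add: tw_ring_simps assms tw_ring_uminus_closed)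
qed

lemma additive_subgroup_vanishing:
  "additive_subgroup (vanishing p m T) (tw_ring p m :: (nat \<Rightarrow>\<^sub>0 'k::comm_ring_1 mpoly) ring)"
proof -
  interpret ring "tw_ring p m :: (nat \<Rightarrow>\<^sub>0 'k mpoly) ring" by (rule ring_tw_ring)
  show ?thesis
  proof (intro additive_subgroupI add.subgroupI)
    show "(vanishing p m T :: (nat \<Rightarrow>\<^sub>0 'k mpoly) set) \<noteq> {}"
      using zero_closed by (force simp: vanishing_def tw_ring_simps)
  next
    fix a :: "nat \<Rightarrow>\<^sub>0 'k mpoly"
    assume "a \<in> vanishing p m T"
    then show "\<ominus>\<^bsub>tw_ring p m\<^esub> a \<in> vanishing p m T"
      by (auto simp: vanishing_def tw_ring_a_inv tw_ring_uminus_closed)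
  next
    fix a b :: "nat \<Rightarrow>\<^sub>0 'k mpoly"
    assume "a \<in> vanishing p m T" "b \<in> vanishing p m T"
    then show "a \<oplus>\<^bsub>tw_ring p m\<^esub> b \<in> vanishing p m T"
      using a_closed[of a b] by (fastforce simp: vanishing_def tw_ring_simps lookup_add)
  qed (auto simp: vanishing_def)
qed

text \<open>A nonzero coefficient of the product at an index in \<open>T\<close> would come from a
  factorization of that index with nonzero coefficients at both factors. Membership in the carrier
  gives the factors the right degrees.\<close>

lemma tw_mult_in_vanishing:
  fixes a c :: "nat \<Rightarrow>\<^sub>0 'k::comm_ring_1 mpoly"
  assumes "a \<in> carrier (tw_ring p m)" "c \<in> carrier (tw_ring p m)"
    and "\<And>i j u t. u \<in> tw_exps p m i \<Longrightarrow> t \<in> tw_exps p m j \<Longrightarrow>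
      (i + j, u + mon_scale (p ^ i) t) \<in> T \<Longrightarrow> coef a i u = 0 \<or> coef c j t = 0"
  shows "tw_mult p a c \<in> vanishing p m T"
proof -
  interpret ring "tw_ring p m :: (nat \<Rightarrow>\<^sub>0 'k mpoly) ring" by (rule ring_tw_ring)
  have "coef (tw_mult p a c) n s = 0" if "(n, s) \<in> T" for n s
  proof (rule ccontr)
    assume "coef (tw_mult p a c) n s \<noteq> 0"
    then obtain i j u t where "n = i + j" "s = u + mon_scale (p ^ i) t" "coef a i u \<noteq> 0" "coef c j t \<noteq> 0"
      by (rule coef_tw_mult_nonzero)
    with assms that show False using coef_carrier by blast
  qed
  then show ?thesis
    using m_closed[of a c] assms(1,2) by (auto simp: vanishing_def tw_ring_simps)
qed

text \<open>\<open>T\<close> is closed under right factors, so its complement absorbs multiplication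
  from the left.\<close>

lemma left_ideal_vanishing:
  assumes "\<And>i j u t. u \<in> tw_exps p m i \<Longrightarrow> t \<in> tw_exps p m j \<Longrightarrow>
      (i + j, u + mon_scale (p ^ i) t) \<in> T \<Longrightarrow> (j, t) \<in> T"
  shows "left_ideal (vanishing p m T) (tw_ring p m)"
  unfolding left_ideal_def tw_ring_simps
proof (intro conjI additive_subgroup_vanishing ballI)
  fix a x :: "nat \<Rightarrow>\<^sub>0 'a mpoly"
  assume "a \<in> vanishing p m T" "x \<in> carrier (tw_ring p m)"
  then show "tw_mult p x a \<in> vanishing p m T"
    using assms by (intro tw_mult_in_vanishing) (fastforce simp: vanishing_def)+
qed

text \<open>Mirror image: \<open>T\<close> is closed under left factors.\<close>

lemma right_ideal_vanishing:
  assumes "\<And>i j u t. u \<in> tw_exps p m i \<Longrightarrow> t \<in> tw_exps p m j \<Longrightarrow>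
      (i + j, u + mon_scale (p ^ i) t) \<in> T \<Longrightarrow> (i, u) \<in> T"
  shows "right_ideal (vanishing p m T) (tw_ring p m)"
  unfolding right_ideal_def tw_ring_simps
proof (intro conjI additive_subgroup_vanishing ballI)
  fix a x :: "nat \<Rightarrow>\<^sub>0 'a mpoly"
  assume "a \<in> vanishing p m T" "x \<in> carrier (tw_ring p m)"
  then show "tw_mult p a x \<in> vanishing p m T"
    using assms by (intro tw_mult_in_vanishing) (fastforce simp: vanishing_def)+
qed

text \<open>Contrapositively, the hypotheses say that the complement of \<open>T\<close> is a
  submonoid.\<close>

lemma subring_vanishing:
  assumes "(0, 0) \<notin> T"
    and "\<And>i j u t. u \<in> tw_exps p m i \<Longrightarrow> t \<in> tw_exps p m j \<Longrightarrow>
      (i + j, u + mon_scale (p ^ i) t) \<in> T \<Longrightarrow> (i, u) \<in> T \<or> (j, t) \<in> T"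
  shows "subring (vanishing p m T) (tw_ring p m :: (nat \<Rightarrow>\<^sub>0 'k::comm_ring_1 mpoly) ring)"
proof -
  interpret ring "tw_ring p m :: (nat \<Rightarrow>\<^sub>0 'k mpoly) ring" by (rule ring_tw_ring)
  interpret V: additive_subgroup "vanishing p m T" "tw_ring p m :: (nat \<Rightarrow>\<^sub>0 'k mpoly) ring"
    by (rule additive_subgroup_vanishing)
  show ?thesis
  proof (rule subringI)
    have "coef (1 :: nat \<Rightarrow>\<^sub>0 'k mpoly) n s = 0" if "(n, s) \<in> T" for n s
      using that assms(1) by (cases "n = 0"; cases "s = 0") (simp_all add: lookup_one)
    then show "\<one>\<^bsub>tw_ring p m\<^esub> \<in> (vanishing p m T :: (nat \<Rightarrow>\<^sub>0 'k mpoly) set)"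
      using one_closed unfolding vanishing_def tw_ring_simps by blast
  next
    fix a b :: "nat \<Rightarrow>\<^sub>0 'k mpoly"
    assume ab: "a \<in> vanishing p m T" "b \<in> vanishing p m T"
    show "a \<otimes>\<^bsub>tw_ring p m\<^esub> b \<in> vanishing p m T"
      unfolding tw_ring_simps
    proof (rule tw_mult_in_vanishing)
      fix i j u t
      assume "u \<in> tw_exps p m i" "t \<in> tw_exps p m j" "(i + j, u + mon_scale (p ^ i) t) \<in> T"
      then have "(i, u) \<in> T \<or> (j, t) \<in> T" by (rule assms(2))
      then show "coef a i u = 0 \<or> coef b j t = 0" using ab[THEN vanishingD(2)] by blast
    qed (fact ab[THEN vanishingD(1)])+
  qed (use V.a_subset V.a_inv_closed V.a_closed abelian_group_axioms in blast)+
qed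

lemma finite_vanishing_degree:
  fixes A :: "(nat \<Rightarrow>\<^sub>0 'b::zero) set"
  assumes "finite A"
  obtains N where "\<And>a n. a \<in> A \<Longrightarrow> n \<ge> N \<Longrightarrow> Poly_Mapping.lookup a n = 0"
proof
  fix a n
  \<comment> \<open>If all elements of \<open>A\<close> are zero, this \<open>Max\<close> is over
    the empty set; its value is then irrelevant, since the bound is invoked only for an actual
    key.\<close>
  assume a: "a \<in> A" and n: "n \<ge> Suc (Max (\<Union>a\<in>A. Poly_Mapping.keys a))"
  have "n \<le> Max (\<Union>a\<in>A. Poly_Mapping.keys a)" if "n \<in> Poly_Mapping.keys a"
    by (rule Max_ge) (use assms a that in auto)
  with n show "Poly_Mapping.lookup a n = 0" by (auto simp: in_keys_iff)
qed

section \<open>Failure of finite generation\<close>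

text \<open>The first summand is -1 modulo every \<open>p ^ i\<close> with \<open>i < n\<close>,
  which makes a left factor too large in \<open>x\<^sub>0\<close> unless \<open>p = 2\<close>. The
  second summand excludes \<open>p = 2\<close>, and the third fills up the degree.\<close>

lemma indecomposable_exponent:
  fixes p m n :: nat
  defines "s \<equiv> Poly_Mapping.single 0 (p ^ (n - 1) - 1) + Poly_Mapping.single 1 1
    + Poly_Mapping.single m ((p ^ (n - 1) - 1) div (p - 1))"
  assumes p: "p \<ge> 2" and m: "m \<ge> 1" "\<not> (p = 2 \<and> m = 1)" and n: "n \<ge> 2"
  shows "s \<in> tw_exps p m n"
    and "0 < i \<Longrightarrow> i < n \<Longrightarrow> u \<in> tw_exps p m i \<Longrightarrow> s \<noteq> u + mon_scale (p ^ i) t"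
proof -
  have "Poly_Mapping.keys s \<subseteq> {0, 1, m}"
    by (auto simp: s_def in_keys_iff lookup_add lookup_single when_def split: if_splits)
  then have keys: "Poly_Mapping.keys s \<subseteq> {..m}" using m(1) by auto
  have split: "(p ^ n - 1) div (p - 1) = (p ^ (n - 1) - 1) div (p - 1) + p ^ (n - 1)"
    using tw_degree_add[of p "n - 1" 1] p n by simp
  have "p ^ (n - 1) \<ge> 1" using p by simp
  moreover have "mon_degree s = p ^ (n - 1) - 1 + 1 + (p ^ (n - 1) - 1) div (p - 1)"
    unfolding s_def mon_degree_add mon_degree_single ..
  ultimately have "mon_degree s = (p ^ n - 1) div (p - 1)" using split by linarith
  then show "s \<in> tw_exps p m n" using keys by (simp add: tw_exps_def)
  show "s \<noteq> u + mon_scale (p ^ i) t" if i: "0 < i" "i < n" and u: "u \<in> tw_exps p m i"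
  proof
    assume eq: "s = u + mon_scale (p ^ i) t"
    let ?u = "Poly_Mapping.lookup u" and ?t = "Poly_Mapping.lookup t"
    have du: "mon_degree u = (p ^ i - 1) div (p - 1)" using u by (simp add: tw_exps_def)
    have pi: "p ^ i \<ge> 2" using p i(1) self_le_power[of p i] by linarith
    have "p ^ (n - 1) - 1 = ?u 0 + p ^ i * ?t 0"
      using arg_cong[OF eq, of "\<lambda>s. Poly_Mapping.lookup s 0"] m
      by (simp add: s_def lookup_add lookup_single lookup_mon_scale when_def)
    then have "p ^ (n - 1) = Suc (?u 0) + p ^ i * ?t 0" using \<open>p ^ (n - 1) \<ge> 1\<close> by linarith
    moreover have "p ^ i dvd p ^ (n - 1)" using i(2) by (intro le_imp_power_dvd) simp
    ultimately have "p ^ i dvd Suc (?u 0)" by (metis dvd_add_left_iff dvd_triv_left)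
    then have u0: "p ^ i - 1 \<le> ?u 0" using dvd_imp_le[of "p ^ i" "Suc (?u 0)"] by linarith
    also have "\<dots> \<le> mon_degree u" by (rule lookup_le_mon_degree)
    finally have le: "p ^ i - 1 \<le> (p ^ i - 1) div (p - 1)" using du by simp
    \<comment> \<open>For \<open>p\<close> at least 3, dividing the positive number
      \<open>p ^ i - 1\<close> by \<open>p - 1\<close> makes it strictly smaller, against
      \<open>le\<close>.\<close>
    have p2: "p = 2"
    proof (rule ccontr)
      assume "p \<noteq> 2"
      then have "(p ^ i - 1) div (p - 1) < p ^ i - 1"
        using p pi by (intro div_less_dividend) linarith+
      with le show False by simp
    qed
    \<comment> \<open>For \<open>p = 2\<close> the total degree of \<open>u\<close> is
      \<open>2 ^ i - 1\<close>, already exhausted by the index 0.\<close>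
    have "?u 1 = 0"
      using lookup_add_le_mon_degree[of 0 1 u] u0 du p2 by simp
    \<comment> \<open>As \<open>p = 2\<close>, the hypotheses leave \<open>m\<close> at least 2, so
      the third summand of \<open>s\<close> does not contribute at index 1.\<close>
    moreover have "1 = ?u 1 + p ^ i * ?t 1"
      using arg_cong[OF eq, of "\<lambda>s. Poly_Mapping.lookup s 1"] m p2
      by (simp add: s_def lookup_add lookup_single lookup_mon_scale when_def)
    ultimately have "p ^ i * ?t 1 = 1" by simp
    then have "p ^ i = 1" by (rule nat_mult_eq_1_iff[THEN iffD1, THEN conjunct1])
    then show False using pi by linarith
  qed
qed

text \<open>Finitely many generators have bounded degree. Beyond that bound, the elements with zero
  coefficient at one indecomposable \<open>(n, s)\<close> form a proper subring that contains the
  generators and the scalars.\<close>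

lemma not_finitely_generated:
  assumes "p \<ge> 2" "m \<ge> 1" "\<not> (p = 2 \<and> m = 1)"
  shows "\<not> finitely_generated_algebra tw_scalars (tw_ring p m :: (nat \<Rightarrow>\<^sub>0 'k::field mpoly) ring)"
proof
  let ?F = "tw_ring p m :: (nat \<Rightarrow>\<^sub>0 'k mpoly) ring"
  interpret ring ?F by (rule ring_tw_ring)
  assume "finitely_generated_algebra tw_scalars ?F"
  then obtain S where S: "finite S" "S \<subseteq> carrier ?F" "generate_ring ?F (tw_scalars \<union> S) = carrier ?F"
    by (auto simp: finitely_generated_algebra_def generates_algebra_def)
  obtain N where N: "\<And>a n. a \<in> S \<Longrightarrow> n \<ge> N \<Longrightarrow> Poly_Mapping.lookup a n = 0"
    using finite_vanishing_degree[OF S(1)] by blast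
  \<comment> \<open>Beyond all degrees of the generators, and at least 2 as
    \<open>indecomposable_exponent\<close> demands.\<close>
  define n where "n = N + 2"
  define s where "s = Poly_Mapping.single 0 (p ^ (n - 1) - 1) + Poly_Mapping.single 1 1
    + Poly_Mapping.single m ((p ^ (n - 1) - 1) div (p - 1))"
  have n: "n \<ge> 2" "n \<ge> N" by (simp_all add: n_def)
  note s = indecomposable_exponent[OF assms n(1), folded s_def]
  have "subring (vanishing p m {(n, s)}) ?F"
  proof (rule subring_vanishing)
    fix i j u t
    assume ut: "u \<in> tw_exps p m i" "t \<in> tw_exps p m j" "(i + j, u + mon_scale (p ^ i) t) \<in> {(n, s)}"
    \<comment> \<open>Indecomposability leaves only factorizations with a factor of degree 0. That
      factor is \<open>(0, 0)\<close>, so the other one is \<open>(n, s)\<close> itself.\<close>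
    then have "i = 0 \<or> i = n" using s(2)[of i u t] by (cases "i = 0"; cases "j = 0") auto
    then show "(i, u) \<in> {(n, s)} \<or> (j, t) \<in> {(n, s)}" using ut by auto
  qed (use n in auto)
  moreover have "tw_scalars \<union> S \<subseteq> carrier ?F" using tw_scalars_central(1) S(2) by blast
  moreover from this have "tw_scalars \<union> S \<subseteq> vanishing p m {(n, s)}"
    using N n by (auto simp: vanishing_def tw_scalars_def lookup_single when_def)
  ultimately have "carrier ?F \<subseteq> vanishing p m {(n, s)}"
    using generate_ring_min_subring1 S(3) by metis
  from subsetD[OF this monomial_in_carrier[OF s(1)]] vanishingD(2)
  have "coef (Poly_Mapping.single n (Poly_Mapping.single s (1::'k))) n s = 0" by blast
  then show False by simp
qed

section \<open>The case of the free algebra\<close>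

text \<open>Induction on the word length, reading the lowest binary digits: \<open>a + b\<close> is
  odd for positive \<open>n\<close>, so exactly one of \<open>a\<close> and \<open>b\<close> is odd,
  and it names the first letter. Removing that letter and halving gives the exponents of the
  remaining word.\<close>

lemma binary_monomial_generated:
  assumes "a + b = 2 ^ n - 1"
  shows "Poly_Mapping.single n (Poly_Mapping.single (Poly_Mapping.single 0 a + Poly_Mapping.single 1 b) 1)
    \<in> generate_ring (tw_ring 2 1 :: (nat \<Rightarrow>\<^sub>0 'k::comm_ring_1 mpoly) ring) (tw_scalars \<union> tw_component 2 1 1)"
    (is "?mon n a b \<in> ?G")
  using assms
proof (induction n arbitrary: a b)
  case 0
  have "?mon 0 0 0 = \<one>\<^bsub>tw_ring 2 1\<^esub>" by (simp add: tw_ring_simps)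
  with 0 show ?case using generate_ring.one[of "tw_ring 2 1"] by (metis add_is_0 diff_self_eq_0 power_0)
next
  case (Suc n)
  have gen: "?mon 1 a b \<in> ?G" if "a + b = 1" for a b
  proof (intro generate_ring.incl UnI2)
    have "Poly_Mapping.keys (Poly_Mapping.single 0 a + Poly_Mapping.single 1 b) \<subseteq> {..1::nat}"
      by (auto simp: in_keys_iff lookup_add lookup_single when_def split: if_splits)
    with that show "?mon 1 a b \<in> tw_component 2 1 1"
      by (simp add: tw_component_def tw_part_def homogeneous_part_def mon_degree_add)
  qed
  \<comment> \<open>Putting a letter in front applies the Frobenius to the tail, which doubles its
    exponents.\<close>
  have step: "?mon (Suc n) (c + 2 * a') (d + 2 * b') \<in> ?G"
    if "c + d = 1" "a' + b' = 2 ^ n - 1" for c d a' b'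
  proof -
    have "?mon 1 c d \<otimes>\<^bsub>tw_ring 2 1\<^esub> ?mon n a' b' \<in> ?G"
      using gen[OF that(1)] Suc.IH[OF that(2)] by (rule generate_ring.eng_mult)
    also have "?mon 1 c d \<otimes>\<^bsub>tw_ring 2 1\<^esub> ?mon n a' b' = ?mon (Suc n) (c + 2 * a') (d + 2 * b')"
      by (simp add: tw_ring_simps tw_mult_single rel_frob_single mult_single mon_scale_add
          mon_scale_single single_add algebra_simps)
    finally show ?thesis .
  qed
  have "(2::nat) ^ n \<ge> 1" by simp
  then have total: "a + b = 2 * (2 ^ n - 1) + 1" using Suc.prems unfolding power_Suc by linarith
  show ?case
  proof (cases "even a")
    case True
    with total have "odd b" by presburger
    with True obtain a' b' where ab: "a = 0 + 2 * a'" "b = 1 + 2 * b'"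
      by (metis add.commute add_0 evenE oddE)
    moreover have "a' + b' = 2 ^ n - 1" using total ab by simp
    ultimately show ?thesis using step[of 0 1 a' b'] by simp
  next
    case False
    with total have "even b" by presburger
    with False obtain a' b' where ab: "a = 1 + 2 * a'" "b = 0 + 2 * b'"
      by (metis add.commute add_0 evenE oddE)
    moreover have "a' + b' = 2 ^ n - 1" using total ab by simp
    ultimately show ?thesis using step[of 1 0 a' b'] by simp
  qed
qed

text \<open>Every element is a sum of monomials with coefficients. The monic monomials are words in
  the two variables, and a coefficient is supplied by left multiplication with a scalar.\<close>

lemma generated_in_degree_1:
  "generates_algebra tw_scalars (tw_ring 2 1 :: (nat \<Rightarrow>\<^sub>0 'k::comm_ring_1 mpoly) ring) (tw_component 2 1 1)"
proof -
  let ?F = "tw_ring 2 1 :: (nat \<Rightarrow>\<^sub>0 'k mpoly) ring"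
  let ?G = "generate_ring ?F (tw_scalars \<union> tw_component 2 1 1)"
  interpret ring ?F by (rule ring_tw_ring)
  have sub: "tw_component 2 1 1 \<subseteq> carrier ?F"
    by (auto simp: tw_component_def tw_ring_def lookup_single when_def) (simp add: tw_part_def)
  then have H: "tw_scalars \<union> tw_component 2 1 1 \<subseteq> carrier ?F" using tw_scalars_central(1) by blast
  have sum: "(\<Sum>i\<in>A. f i) \<in> ?G" if "\<And>i. i \<in> A \<Longrightarrow> f i \<in> ?G" for A :: "'i set" and f
    using that
  proof (induction A rule: infinite_finite_induct)
    case (insert x A)
    then show ?case using generate_ring.eng_add[of "f x" ?F _ "\<Sum>i\<in>A. f i"] by (simp add: tw_ring_simps)
  qed (use zero_in_generate in \<open>simp_all add: tw_ring_simps\<close>)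
  have mon: "Poly_Mapping.single n (Poly_Mapping.single t c) \<in> ?G" if "t \<in> tw_exps 2 1 n" for n t and c :: 'k
  proof -
    let ?a = "Poly_Mapping.lookup t 0" and ?b = "Poly_Mapping.lookup t 1"
    have t: "t = Poly_Mapping.single 0 ?a + Poly_Mapping.single 1 ?b"
      using that by (intro binary_exponent) (simp add: tw_exps_def)
    have "mon_degree (Poly_Mapping.single 0 ?a + Poly_Mapping.single 1 ?b) = 2 ^ n - 1"
      using that t by (simp add: tw_exps_two)
    then have "?a + ?b = 2 ^ n - 1" by (simp add: mon_degree_add)
    from binary_monomial_generated[OF this] have "Poly_Mapping.single n (Poly_Mapping.single t 1) \<in> ?G"
      using t by simp
    moreover have "Poly_Mapping.single 0 (Const c) \<in> ?G"
      by (intro generate_ring.incl) (auto simp: tw_scalars_def)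
    ultimately have "Poly_Mapping.single 0 (Const c) \<otimes>\<^bsub>?F\<^esub> Poly_Mapping.single n (Poly_Mapping.single t 1) \<in> ?G"
      by (intro generate_ring.eng_mult)
    then show ?thesis by (simp add: tw_ring_simps tw_mult_single Const_def mult_single)
  qed
  have "a \<in> ?G" if "a \<in> carrier ?F" for a
  proof -
    have "Poly_Mapping.single n (Poly_Mapping.lookup a n) \<in> ?G" for n
    proof -
      let ?P = "Poly_Mapping.lookup a n"
      have "Poly_Mapping.single n ?P
          = Poly_Mapping.single n (\<Sum>t\<in>Poly_Mapping.keys ?P. Poly_Mapping.single t (Poly_Mapping.lookup ?P t))"
        by (simp add: sum_single_lookup)
      also have "\<dots> = (\<Sum>t\<in>Poly_Mapping.keys ?P.
          Poly_Mapping.single n (Poly_Mapping.single t (Poly_Mapping.lookup ?P t)))"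
        by (subst sum_comp_morphism[symmetric]) (simp_all add: single_add)
      also have "\<dots> \<in> ?G"
        using coef_carrier[OF that] by (intro sum mon) (auto simp: in_keys_iff)
      finally show ?thesis .
    qed
    then have "(\<Sum>n\<in>Poly_Mapping.keys a. Poly_Mapping.single n (Poly_Mapping.lookup a n)) \<in> ?G"
      by (intro sum)
    then show ?thesis by (simp add: sum_single_lookup)
  qed
  then have "?G = carrier ?F" using generate_ring_incl[OF H] by blast
  then show ?thesis using sub by (simp add: generates_algebra_def)
qed

section \<open>The ideal of words containing \<open>x\<close>, and failure of both noetherian
  conditions\<close>

text \<open>The words \<open>y\<^sup>n\<close>: the twisted product of \<open>n\<close> copies of
  \<open>y\<close> has exponent 1 + 2 + ... + \<open>2 ^ (n - 1)\<close>. Hence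
  \<open>vanishing 2 1 y_powers\<close> is spanned by the words containing \<open>x\<close>.\<close>

definition y_powers :: "(nat \<times> (nat \<Rightarrow>\<^sub>0 nat)) set" where
  "y_powers = {(n, Poly_Mapping.single 1 (2 ^ n - 1)) | n. True}"

text \<open>Without \<open>x\<^sub>0\<close> the degree determines the exponent of
  \<open>x\<^sub>1\<close>, so membership becomes a test at index 0 alone.\<close>

lemma y_powers_iff:
  assumes "t \<in> tw_exps 2 1 n"
  shows "(n, t) \<in> y_powers \<longleftrightarrow> Poly_Mapping.lookup t 0 = 0"
proof
  assume t0: "Poly_Mapping.lookup t 0 = 0"
  have "t = Poly_Mapping.single 1 (Poly_Mapping.lookup t 1)"
    using binary_exponent[of t] assms t0 by (simp add: tw_exps_def)
  moreover from this have "Poly_Mapping.lookup t 1 = 2 ^ n - 1"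
    using assms by (metis mon_degree_single tw_exps_two)
  ultimately show "(n, t) \<in> y_powers" by (auto simp: y_powers_def)
qed (auto simp: y_powers_def lookup_single)

text \<open>A sum of natural numbers vanishes only if both terms do. The two conclusions make
  \<open>vanishing 2 1 y_powers\<close> a right and a left ideal, respectively.\<close>

lemma y_powers_factor:
  assumes "u \<in> tw_exps 2 1 i" "t \<in> tw_exps 2 1 j" "(i + j, u + mon_scale (2 ^ i) t) \<in> y_powers"
  shows "(i, u) \<in> y_powers" "(j, t) \<in> y_powers"
proof -
  have "Poly_Mapping.lookup (u + mon_scale (2 ^ i) t) 0 = 0"
    using assms(3) by (auto simp: y_powers_def lookup_single simp del: lookup_add)
  then show "(i, u) \<in> y_powers" "(j, t) \<in> y_powers"
    using assms(1,2) by (simp_all add: y_powers_iff lookup_add lookup_mon_scale)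
qed

text \<open>The monomial at \<open>(n, s)\<close> separates the two sets, since it involves
  \<open>x\<close> and so is no power of \<open>y\<close>.\<close>

lemma vanishing_insert_proper:
  assumes "s \<in> tw_exps 2 1 n" "Poly_Mapping.lookup s 0 \<noteq> 0"
  shows "\<not> vanishing 2 1 y_powers \<subseteq> (vanishing 2 1 (insert (n, s) y_powers) :: (nat \<Rightarrow>\<^sub>0 'k::field mpoly) set)"
proof -
  let ?a = "Poly_Mapping.single n (Poly_Mapping.single s (1::'k))"
  have "(n, s) \<notin> y_powers" using y_powers_iff[OF assms(1)] assms(2) by simp
  then have "?a \<in> vanishing 2 1 y_powers" "?a \<notin> vanishing 2 1 (insert (n, s) y_powers)"
    using monomial_in_carrier[OF assms(1), of 1]
    by (auto simp: vanishing_def lookup_single when_def)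
  then show ?thesis by blast
qed

lemma binary_exponent_in_tw_exps:
  "a + b = 2 ^ n - 1 \<Longrightarrow> Poly_Mapping.single 0 a + Poly_Mapping.single 1 b \<in> tw_exps 2 1 n"
  by (auto simp: tw_exps_two mon_degree_add in_keys_iff lookup_add lookup_single when_def
      split: if_splits)

text \<open>A finite \<open>A\<close> has no terms in degree \<open>n\<close> or above, so it
  survives requiring a zero coefficient at \<open>x y\<^sup>n\<close> as well. Proper right factors
  of this word are powers of \<open>y\<close>, so the result is a left ideal containing
  \<open>A\<close> but not \<open>?I\<close>.\<close>

lemma not_left_noetherian: "\<not> left_noetherian (tw_ring 2 1 :: (nat \<Rightarrow>\<^sub>0 'k::field mpoly) ring)"
proof
  let ?F = "tw_ring 2 1 :: (nat \<Rightarrow>\<^sub>0 'k mpoly) ring"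
  let ?I = "vanishing 2 1 y_powers :: (nat \<Rightarrow>\<^sub>0 'k mpoly) set"
  assume noeth: "left_noetherian ?F"
  have "left_ideal ?I ?F" by (rule left_ideal_vanishing) (rule y_powers_factor)
  with noeth have "\<exists>A \<subseteq> carrier ?F. finite A \<and> ?I = \<Inter>{J. left_ideal J ?F \<and> A \<subseteq> J}"
    unfolding left_noetherian_def by (elim allE impE)
  then obtain A where A: "finite A" "?I = \<Inter>{J. left_ideal J ?F \<and> A \<subseteq> J}"
    by (elim exE conjE)
  obtain n where n: "\<And>a l. a \<in> A \<Longrightarrow> l \<ge> n \<Longrightarrow> Poly_Mapping.lookup a l = 0"
    using finite_vanishing_degree[OF A(1)] by blast
  \<comment> \<open>the exponent of the word \<open>x y\<^sup>n\<close>\<close>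
  define s where "s = Poly_Mapping.single (0::nat) 1 + Poly_Mapping.single 1 (2 ^ Suc n - 2 :: nat)"
  let ?T = "insert (Suc n, s) y_powers"
  have s0: "Poly_Mapping.lookup s 0 = 1" by (simp add: s_def lookup_add lookup_single)
  have "(2::nat) ^ Suc n \<ge> 2" by simp
  then have s: "s \<in> tw_exps 2 1 (Suc n)"
    unfolding s_def by (intro binary_exponent_in_tw_exps) linarith
  have "left_ideal (vanishing 2 1 ?T :: (nat \<Rightarrow>\<^sub>0 'k mpoly) set) ?F"
  proof (rule left_ideal_vanishing)
    fix i j u t
    assume u: "u \<in> tw_exps 2 1 i" and t: "t \<in> tw_exps 2 1 j"
      and "(i + j, u + mon_scale (2 ^ i) t) \<in> ?T"
    then consider "(i + j, u + mon_scale (2 ^ i) t) \<in> y_powers"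
      | "i + j = Suc n" "u + mon_scale (2 ^ i) t = s" by blast
    then show "(j, t) \<in> ?T"
    proof cases
      case 1
      then show ?thesis using y_powers_factor u t by blast
    next
      case 2
      show ?thesis
      proof (cases "i = 0")
        case True
        then show ?thesis using 2 u by simp
      next
        case False
        \<comment> \<open>The letter \<open>x\<close> sits in the lowest binary digit, so it belongs
          to the nonempty left factor \<open>u\<close>.\<close>
        have "Poly_Mapping.lookup u 0 + 2 ^ i * Poly_Mapping.lookup t 0 = 1"
          using s0 2(2) by (auto simp: lookup_add lookup_mon_scale)
        moreover have "(2::nat) ^ i \<ge> 2" using False self_le_power[of "2::nat" i] by simp
        ultimately have "Poly_Mapping.lookup t 0 = 0"
          by (cases "Poly_Mapping.lookup t 0") auto
        then show ?thesis using y_powers_iff[OF t] by simp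
      qed
    qed
  qed
  moreover have "A \<subseteq> ?I" using A(2) by blast
  then have "A \<subseteq> vanishing 2 1 ?T" using n by (auto simp: vanishing_def)
  ultimately have "?I \<subseteq> vanishing 2 1 ?T" using A(2) by blast
  then show False using vanishing_insert_proper[OF s, where 'k = 'k] s0 by simp
qed

text \<open>The same argument with \<open>y\<^sup>n x\<close>, whose proper left factors are powers
  of \<open>y\<close>.\<close>

lemma not_right_noetherian: "\<not> right_noetherian (tw_ring 2 1 :: (nat \<Rightarrow>\<^sub>0 'k::field mpoly) ring)"
proof
  let ?F = "tw_ring 2 1 :: (nat \<Rightarrow>\<^sub>0 'k mpoly) ring"
  let ?I = "vanishing 2 1 y_powers :: (nat \<Rightarrow>\<^sub>0 'k mpoly) set"
  assume noeth: "right_noetherian ?F"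
  have "right_ideal ?I ?F" by (rule right_ideal_vanishing) (rule y_powers_factor)
  with noeth have "\<exists>A \<subseteq> carrier ?F. finite A \<and> ?I = \<Inter>{J. right_ideal J ?F \<and> A \<subseteq> J}"
    unfolding right_noetherian_def by (elim allE impE)
  then obtain A where A: "finite A" "?I = \<Inter>{J. right_ideal J ?F \<and> A \<subseteq> J}"
    by (elim exE conjE)
  obtain n where n: "\<And>a l. a \<in> A \<Longrightarrow> l \<ge> n \<Longrightarrow> Poly_Mapping.lookup a l = 0"
    using finite_vanishing_degree[OF A(1)] by blast
  \<comment> \<open>the exponent of the word \<open>y\<^sup>n x\<close>\<close>
  define s where "s = Poly_Mapping.single (0::nat) (2 ^ n) + Poly_Mapping.single 1 (2 ^ n - 1 :: nat)"
  let ?T = "insert (Suc n, s) y_powers"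
  have s0: "Poly_Mapping.lookup s 0 = 2 ^ n" by (simp add: s_def lookup_add lookup_single)
  have "(2::nat) ^ n \<ge> 1" by simp
  then have s: "s \<in> tw_exps 2 1 (Suc n)"
    unfolding s_def by (intro binary_exponent_in_tw_exps) simp
  have "right_ideal (vanishing 2 1 ?T :: (nat \<Rightarrow>\<^sub>0 'k mpoly) set) ?F"
  proof (rule right_ideal_vanishing)
    fix i j u t
    assume u: "u \<in> tw_exps 2 1 i" and t: "t \<in> tw_exps 2 1 j"
      and "(i + j, u + mon_scale (2 ^ i) t) \<in> ?T"
    then consider "(i + j, u + mon_scale (2 ^ i) t) \<in> y_powers"
      | "i + j = Suc n" "u + mon_scale (2 ^ i) t = s" by blast
    then show "(i, u) \<in> ?T"
    proof cases
      case 1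
      then show ?thesis using y_powers_factor u t by blast
    next
      case 2
      show ?thesis
      proof (cases "j = 0")
        case True
        then show ?thesis using 2 t by simp
      next
        case False
        have "2 ^ n = Poly_Mapping.lookup u 0 + 2 ^ i * Poly_Mapping.lookup t 0"
          using s0 2(2) by (auto simp: lookup_add lookup_mon_scale)
        \<comment> \<open>A nonempty right factor leaves \<open>i\<close> at most \<open>n\<close>.
          The exponent of \<open>x\<close> in \<open>u\<close> is then divisible by
          \<open>2 ^ i\<close>, yet bounded by the total degree \<open>2 ^ i - 1\<close>, so it is
          0.\<close>
        moreover have "(2::nat) ^ i dvd 2 ^ n" using False 2(1) by (intro le_imp_power_dvd) simp
        ultimately have "2 ^ i dvd Poly_Mapping.lookup u 0" by (metis dvd_add_left_iff dvd_triv_left)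
        moreover have "Poly_Mapping.lookup u 0 < 2 ^ i"
          using lookup_le_mon_degree[of u 0] u by (simp add: tw_exps_two less_eq_Suc_le)
            (metis One_nat_def Suc_pred le_SucI not_less_eq_eq zero_less_numeral zero_less_power)
        ultimately have "Poly_Mapping.lookup u 0 = 0" by (meson dvd_imp_le leD neq0_conv)
        then show ?thesis using y_powers_iff[OF u] by simp
      qed
    qed
  qed
  moreover have "A \<subseteq> ?I" using A(2) by blast
  then have "A \<subseteq> vanishing 2 1 ?T" using n by (auto simp: vanishing_def)
  ultimately have "?I \<subseteq> vanishing 2 1 ?T" using A(2) by blast
  then show False using vanishing_insert_proper[OF s, where 'k = 'k] s0 by simp
qed

theorem proposition1p2:
  fixes p m :: nat and F :: "(nat \<Rightarrow>\<^sub>0 'k::field mpoly) ring"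
  assumes "perfect_field TYPE('k)" and "CHAR('k) = p" and "p > 0" and "m \<ge> 1"
    and "F = tw_ring p m"
  shows "(\<not> (p = 2 \<and> m = 1) \<longrightarrow> \<not> finitely_generated_algebra tw_scalars F) \<and>
    (p = 2 \<and> m = 1 \<longrightarrow>
       generates_algebra tw_scalars F (tw_component p m 1) \<and>
       \<not> left_noetherian F \<and> \<not> right_noetherian F)"
proof -
  have "p \<noteq> 1" using assms(2) CHAR_not_1[where 'a = 'k] by auto
  with assms(3) have "p \<ge> 2" by simp
  then show ?thesis
    unfolding assms(5)
    using not_finitely_generated[OF _ assms(4), where 'k = 'k] generated_in_degree_1[where 'k = 'k]
      not_left_noetherian[where 'k = 'k] not_right_noetherian[where 'k = 'k]
    by auto
qed

end
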